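(* Let $\mathscr{V}$ be a left skew-closed category, let $\mathscr{A}$ be a $\mathscr{V}$-category, let $K$ be an object of $\mathscr{A}$, and let $P$ be a presheaf on $\mathscr{A}$. Then the structure morphisms $P_{K,A}:PK\to[\mathscr{A}(A,K),PA]$ ($A\in\mathrm{ob}\mathscr{A}$) form a cone over the diagram defining the presheaf hom $\hat{\mathscr{A}}(\mathrm{y}K,P)$, and they induce an isomorphism $$PK\cong\hat{\mathscr{A}}(\mathrm{y}K,P);$$ that is, $PK$ together with the morphisms $P_{K,A}$ is a limit of that diagram.
   Context: **Left skew-closed category.** A left skew-closed category $\mathscr{V}$ consists of a category $\mathscr{V}$, a functor $[-,-]:\mathscr{V}^{\mathrm{op}}\times\mathscr{V}\to\mathscr{V}$, an object $I$, and families of morphisms $i_A:[I,A]\to A$, $j_A:I\to[A,A]$, $L^A_{B,C}:[B,C]\to[[A,B],[A,C]]$. Here $i_A$ is natural in $A$; $j$ is (extraordinary) natural in $A$, i.e. $[f,1]j_B=[1,f]j_A$ for $f:A\to B$; $L^A_{B,C}$ is natural in $B,C$ and (extraordinary) natural in $A$, i.e. $[1,[f,1]]L^{A'}_{B,C}=[[f,1],1]L^A_{B,C}$ for $f:A\to A'$. The axioms are: 1. $[L^A_{B,C},1]\,L^{[A,B]}_{[A,C],[A,D]}\,L^A_{C,D}=[1,L^A_{B,D}]\,L^B_{C,D}:[C,D]\to[[B,C],[[A,B],[A,D]]]$; 2. $i_{[A,C]}\,[j_A,1]\,L^A_{A,C}=1_{[A,C]}$; 3. $L^A_{B,B}\,j_B=j_{[A,B]}$;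 4. $[1,i_C]\,L^I_{B,C}=[i_B,1]:[B,C]\to[[I,B],C]$; 5. $i_I\,j_I=1_I$. No invertibility of $i$, $j$, $L$ is assumed. **$\mathscr{V}$-category.** A $\mathscr{V}$-category $\mathscr{A}$ consists of a set $\mathrm{ob}\mathscr{A}$ of objects, an object $\mathscr{A}(A,B)$ of $\mathscr{V}$ for all objects $A,B$, morphisms $j_A:I\to\mathscr{A}(A,A)$, and morphisms $L^A_{B,C}:\mathscr{A}(B,C)\to[\mathscr{A}(A,B),\mathscr{A}(A,C)]$ in $\mathscr{V}$, such that - $[L^A_{B,C},1]\,L^{\mathscr{A}(A,B)}_{\mathscr{A}(A,C),\mathscr{A}(A,D)}\,L^A_{C,D}=[1,L^A_{B,D}]\,L^B_{C,D}:\mathscr{A}(C,D)\to[\mathscr{A}(B,C),[\mathscr{A}(A,B),\mathscr{A}(A,D)]]$; - $i_{\mathscr{A}(A,C)}\,[j_A,1]\,L^A_{A,C}=1_{\mathscr{A}(A,C)}$; - $L^A_{B,B}\,j_B=j_{\mathscr{A}(A,B)}$. (In these, $L$ with superscript an object of $\mathscr{V}$ is that of $\mathscr{V}$; likewise for $j$ with subscript an object of $\mathscr{V}$.) **Presheaf.** A presheaf $P$ on $\mathscr{A}$ consists of a function $P:\mathrm{ob}\mathscr{A}\to\mathrm{ob}\mathscr{V}$ and morphisms $P_{A,B}:PA\to[\mathscr{A}(B,A),PB]$ in $\mathscr{V}$ such that for all $A,B,C$ - $[L^B_{C,A},1]\,L^{\mathscr{A}(B,C)}_{\mathscr{A}(B,A),PB}\,P_{A,B}=[1,P_{C,B}]\,P_{A,C}:PA\to[\mathscr{A}(C,A),[\mathscr{A}(B,C),PB]]$;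 - $i_{PA}\,[j_A,1]\,P_{A,A}=1_{PA}$. For an object $K$ of $\mathscr{A}$, the presheaf $\mathrm{y}K=\mathscr{A}(-,K)$ has $(\mathrm{y}K)A=\mathscr{A}(A,K)$ and $(\mathrm{y}K)_{A,B}=L^B_{A,K}:\mathscr{A}(A,K)\to[\mathscr{A}(B,A),\mathscr{A}(B,K)]$. **Presheaf hom.** For presheaves $P,Q$ on $\mathscr{A}$, $\hat{\mathscr{A}}(P,Q)$ is the object of $\mathscr{V}$ (when it exists) that is the limit, with projections $p_A:\hat{\mathscr{A}}(P,Q)\to[PA,QA]$ ($A\in\mathrm{ob}\mathscr{A}$), universal among families of morphisms $p_A:X\to[PA,QA]$ with common domain satisfying, for all objects $A,B$ of $\mathscr{A}$, $$[1,Q_{A,B}]\circ p_A=[P_{A,B},1]\circ L^{\mathscr{A}(B,A)}_{PB,QB}\circ p_B: X\to[PA,[\mathscr{A}(B,A),QB]].$$ *)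

theory Defs
  imports Main
begin

section \<open>Categories\<close>

record ('o, 'm) category_data =
  Obj :: "'o set"
  Arr :: "'m set"
  Dom :: "'m \<Rightarrow> 'o"
  Cod :: "'m \<Rightarrow> 'o"
  Ident :: "'o \<Rightarrow> 'm" ("\<one>\<index>")
  Comp :: "'m \<Rightarrow> 'm \<Rightarrow> 'm" (infixr "\<cdot>\<index>" 70)

definition hom :: "('o, 'm, 'z) category_data_scheme \<Rightarrow> 'o \<Rightarrow> 'o \<Rightarrow> 'm set" ("Hom\<index>")
  where "hom C A B = {f \<in> Arr C. Dom C f = A \<and> Cod C f = B}"

locale category =
  fixes C :: "('o, 'm, 'z) category_data_scheme" (structure)
  assumes dom_obj: "f \<in> Arr C \<Longrightarrow> Dom C f \<in> Obj C"
    and cod_obj: "f \<in> Arr C \<Longrightarrow> Cod C f \<in> Obj C"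
    and ident_hom: "A \<in> Obj C \<Longrightarrow> \<one> A \<in> Hom A A"
    and comp_hom: "\<lbrakk>f \<in> Hom A B; g \<in> Hom B D\<rbrakk> \<Longrightarrow> g \<cdot> f \<in> Hom A D"
    and comp_ident_left: "f \<in> Hom A B \<Longrightarrow> \<one> B \<cdot> f = f"
    and comp_ident_right: "f \<in> Hom A B \<Longrightarrow> f \<cdot> \<one> A = f"
    and comp_assoc:
      "\<lbrakk>f \<in> Hom A B; g \<in> Hom B D; h \<in> Hom D E\<rbrakk> \<Longrightarrow> (h \<cdot> g) \<cdot> f = h \<cdot> (g \<cdot> f)"

definition is_iso :: "('o, 'm, 'z) category_data_scheme \<Rightarrow> 'o \<Rightarrow> 'o \<Rightarrow> 'm \<Rightarrow> bool"
  where "is_iso C A B f \<longleftrightarrow>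
    f \<in> hom C A B \<and>
    (\<exists>g \<in> hom C B A. g \<cdot>\<^bsub>C\<^esub> f = \<one>\<^bsub>C\<^esub> A \<and> f \<cdot>\<^bsub>C\<^esub> g = \<one>\<^bsub>C\<^esub> B)"


section \<open>Left skew-closed categories\<close>

text \<open>
  The functor \<open>[-,-]\<close> is written \<open>\<langle>A, B\<rangle>\<close> on objects and \<open>\<langle>f; g\<rangle>\<close> on morphisms
  (contravariant in \<open>f\<close>), and \<open>\<LL> A B C\<close> stands for the component of \<open>L\<close> with
  superscript \<open>A\<close> and subscripts \<open>B\<close>, \<open>C\<close>.
\<close>

record ('o, 'm) skew_closed_data = "('o, 'm) category_data" +
  ihom_obj :: "'o \<Rightarrow> 'o \<Rightarrow> 'o" ("\<langle>_, _\<rangle>\<index>")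
  ihom_map :: "'m \<Rightarrow> 'm \<Rightarrow> 'm" ("\<langle>_; _\<rangle>\<index>")
  unit_obj :: 'o ("\<I>\<index>")
  skew_i :: "'o \<Rightarrow> 'm" ("\<ii>\<index>")
  skew_j :: "'o \<Rightarrow> 'm" ("\<jj>\<index>")
  skew_L :: "'o \<Rightarrow> 'o \<Rightarrow> 'o \<Rightarrow> 'm" ("\<LL>\<index>")

locale left_skew_closed_category = category V
  for V :: "('o, 'm) skew_closed_data" (structure) +
  assumes ihom_obj_closed: "\<lbrakk>A \<in> Obj V; B \<in> Obj V\<rbrakk> \<Longrightarrow> \<langle>A, B\<rangle> \<in> Obj V"
    and ihom_map_hom:
      "\<lbrakk>f \<in> Hom A' A; g \<in> Hom B B'\<rbrakk> \<Longrightarrow> \<langle>f; g\<rangle> \<in> Hom \<langle>A, B\<rangle> \<langle>A', B'\<rangle>"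
    and ihom_ident:
      "\<lbrakk>A \<in> Obj V; B \<in> Obj V\<rbrakk> \<Longrightarrow> \<langle>\<one> A; \<one> B\<rangle> = \<one> \<langle>A, B\<rangle>"
    and ihom_comp:
      "\<lbrakk>f \<in> Hom A' A; f' \<in> Hom A'' A'; g \<in> Hom B B'; g' \<in> Hom B' B''\<rbrakk>
        \<Longrightarrow> \<langle>f \<cdot> f'; g' \<cdot> g\<rangle> = \<langle>f'; g'\<rangle> \<cdot> \<langle>f; g\<rangle>"
    and unit_obj_closed: "\<I> \<in> Obj V"
    and i_hom: "A \<in> Obj V \<Longrightarrow> \<ii> A \<in> Hom \<langle>\<I>, A\<rangle> A"
    and j_hom: "A \<in> Obj V \<Longrightarrow> \<jj> A \<in> Hom \<I> \<langle>A, A\<rangle>"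
    and L_hom:
      "\<lbrakk>A \<in> Obj V; B \<in> Obj V; C \<in> Obj V\<rbrakk>
        \<Longrightarrow> \<LL> A B C \<in> Hom \<langle>B, C\<rangle> \<langle>\<langle>A, B\<rangle>, \<langle>A, C\<rangle>\<rangle>"
    and i_natural: "f \<in> Hom A B \<Longrightarrow> f \<cdot> \<ii> A = \<ii> B \<cdot> \<langle>\<one> \<I>; f\<rangle>"
    and j_natural: "f \<in> Hom A B \<Longrightarrow> \<langle>f; \<one> B\<rangle> \<cdot> \<jj> B = \<langle>\<one> A; f\<rangle> \<cdot> \<jj> A"
    and L_natural_sub:
      "\<lbrakk>A \<in> Obj V; g \<in> Hom B' B; h \<in> Hom C C'\<rbrakk>
        \<Longrightarrow> \<langle>\<langle>\<one> A; g\<rangle>; \<langle>\<one> A; h\<rangle>\<rangle> \<cdot> \<LL> A B C = \<LL> A B' C' \<cdot> \<langle>g; h\<rangle>"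
    and L_natural_super:
      "\<lbrakk>f \<in> Hom A A'; B \<in> Obj V; C \<in> Obj V\<rbrakk>
        \<Longrightarrow> \<langle>\<one> \<langle>A', B\<rangle>; \<langle>f; \<one> C\<rangle>\<rangle> \<cdot> \<LL> A' B C
          = \<langle>\<langle>f; \<one> B\<rangle>; \<one> \<langle>A, C\<rangle>\<rangle> \<cdot> \<LL> A B C"
    and skew_assoc:
      "\<lbrakk>A \<in> Obj V; B \<in> Obj V; C \<in> Obj V; D \<in> Obj V\<rbrakk>
        \<Longrightarrow> \<langle>\<LL> A B C; \<one> \<langle>\<langle>A, B\<rangle>, \<langle>A, D\<rangle>\<rangle>\<rangle> \<cdot> \<LL> \<langle>A, B\<rangle> \<langle>A, C\<rangle> \<langle>A, D\<rangle> \<cdot> \<LL> A C D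
          = \<langle>\<one> \<langle>B, C\<rangle>; \<LL> A B D\<rangle> \<cdot> \<LL> B C D"
    and skew_i_j_L:
      "\<lbrakk>A \<in> Obj V; C \<in> Obj V\<rbrakk>
        \<Longrightarrow> \<ii> \<langle>A, C\<rangle> \<cdot> \<langle>\<jj> A; \<one> \<langle>A, C\<rangle>\<rangle> \<cdot> \<LL> A A C = \<one> \<langle>A, C\<rangle>"
    and skew_L_j:
      "\<lbrakk>A \<in> Obj V; B \<in> Obj V\<rbrakk> \<Longrightarrow> \<LL> A B B \<cdot> \<jj> B = \<jj> \<langle>A, B\<rangle>"
    and skew_i_L:
      "\<lbrakk>B \<in> Obj V; C \<in> Obj V\<rbrakk>
        \<Longrightarrow> \<langle>\<one> \<langle>\<I>, B\<rangle>; \<ii> C\<rangle> \<cdot> \<LL> \<I> B C = \<langle>\<ii> B; \<one> C\<rangle>"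
    and skew_i_j: "\<ii> \<I> \<cdot> \<jj> \<I> = \<one> \<I>"


section \<open>Enriched categories and presheaves\<close>

record ('a, 'o, 'm) enriched_data =
  EObj :: "'a set"
  EHom :: "'a \<Rightarrow> 'a \<Rightarrow> 'o"
  Ej :: "'a \<Rightarrow> 'm"
  EL :: "'a \<Rightarrow> 'a \<Rightarrow> 'a \<Rightarrow> 'm"

locale enriched_category = left_skew_closed_category V
  for V :: "('o, 'm) skew_closed_data" (structure) +
  fixes \<A> :: "('a, 'o, 'm) enriched_data"
  assumes EHom_obj: "\<lbrakk>A \<in> EObj \<A>; B \<in> EObj \<A>\<rbrakk> \<Longrightarrow> EHom \<A> A B \<in> Obj V"
    and Ej_hom: "A \<in> EObj \<A> \<Longrightarrow> Ej \<A> A \<in> Hom \<I> (EHom \<A> A A)"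
    and EL_hom:
      "\<lbrakk>A \<in> EObj \<A>; B \<in> EObj \<A>; C \<in> EObj \<A>\<rbrakk>
        \<Longrightarrow> EL \<A> A B C \<in> Hom (EHom \<A> B C) \<langle>EHom \<A> A B, EHom \<A> A C\<rangle>"
    and enriched_assoc:
      "\<lbrakk>A \<in> EObj \<A>; B \<in> EObj \<A>; C \<in> EObj \<A>; D \<in> EObj \<A>\<rbrakk>
        \<Longrightarrow> \<langle>EL \<A> A B C; \<one> \<langle>EHom \<A> A B, EHom \<A> A D\<rangle>\<rangle>
              \<cdot> \<LL> (EHom \<A> A B) (EHom \<A> A C) (EHom \<A> A D) \<cdot> EL \<A> A C D
          = \<langle>\<one> (EHom \<A> B C); EL \<A> A B D\<rangle> \<cdot> EL \<A> B C D"
    and enriched_i_j_L: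
      "\<lbrakk>A \<in> EObj \<A>; C \<in> EObj \<A>\<rbrakk>
        \<Longrightarrow> \<ii> (EHom \<A> A C) \<cdot> \<langle>Ej \<A> A; \<one> (EHom \<A> A C)\<rangle> \<cdot> EL \<A> A A C
          = \<one> (EHom \<A> A C)"
    and enriched_L_j:
      "\<lbrakk>A \<in> EObj \<A>; B \<in> EObj \<A>\<rbrakk> \<Longrightarrow> EL \<A> A B B \<cdot> Ej \<A> B = \<jj> (EHom \<A> A B)"

record ('a, 'o, 'm) presheaf_data =
  PObj :: "'a \<Rightarrow> 'o"
  PMor :: "'a \<Rightarrow> 'a \<Rightarrow> 'm"

locale presheaf = enriched_category V \<A>
  for V :: "('o, 'm) skew_closed_data" (structure)
    and \<A> :: "('a, 'o, 'm) enriched_data" +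
  fixes P :: "('a, 'o, 'm) presheaf_data"
  assumes PObj_obj: "A \<in> EObj \<A> \<Longrightarrow> PObj P A \<in> Obj V"
    and PMor_hom:
      "\<lbrakk>A \<in> EObj \<A>; B \<in> EObj \<A>\<rbrakk>
        \<Longrightarrow> PMor P A B \<in> Hom (PObj P A) \<langle>EHom \<A> B A, PObj P B\<rangle>"
    and presheaf_assoc:
      "\<lbrakk>A \<in> EObj \<A>; B \<in> EObj \<A>; C \<in> EObj \<A>\<rbrakk>
        \<Longrightarrow> \<langle>EL \<A> B C A; \<one> \<langle>EHom \<A> B C, PObj P B\<rangle>\<rangle>
              \<cdot> \<LL> (EHom \<A> B C) (EHom \<A> B A) (PObj P B) \<cdot> PMor P A B
          = \<langle>\<one> (EHom \<A> C A); PMor P C B\<rangle> \<cdot> PMor P A C"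
    and presheaf_unit:
      "A \<in> EObj \<A>
        \<Longrightarrow> \<ii> (PObj P A) \<cdot> \<langle>Ej \<A> A; \<one> (PObj P A)\<rangle> \<cdot> PMor P A A = \<one> (PObj P A)"

definition yoneda :: "('a, 'o, 'm) enriched_data \<Rightarrow> 'a \<Rightarrow> ('a, 'o, 'm) presheaf_data"
  where "yoneda \<A> K = \<lparr>PObj = (\<lambda>A. EHom \<A> A K), PMor = (\<lambda>A B. EL \<A> B A K)\<rparr>"

lemma (in enriched_category) presheaf_yoneda:
  assumes "K \<in> EObj \<A>"
  shows "presheaf V \<A> (yoneda \<A> K)"
  using assms
  by unfold_locales
    (simp_all add: yoneda_def EHom_obj EL_hom enriched_assoc enriched_i_j_L)


section \<open>The presheaf hom\<close>

definition presheaf_hom_cone ::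
  "('o, 'm) skew_closed_data \<Rightarrow> ('a, 'o, 'm) enriched_data
    \<Rightarrow> ('a, 'o, 'm) presheaf_data \<Rightarrow> ('a, 'o, 'm) presheaf_data
    \<Rightarrow> 'o \<Rightarrow> ('a \<Rightarrow> 'm) \<Rightarrow> bool"
  where "presheaf_hom_cone V \<A> P Q X p \<longleftrightarrow>
    X \<in> Obj V \<and>
    (\<forall>A \<in> EObj \<A>. p A \<in> hom V X \<langle>PObj P A, PObj Q A\<rangle>\<^bsub>V\<^esub>) \<and>
    (\<forall>A \<in> EObj \<A>. \<forall>B \<in> EObj \<A>.
      \<langle>\<one>\<^bsub>V\<^esub> (PObj P A); PMor Q A B\<rangle>\<^bsub>V\<^esub> \<cdot>\<^bsub>V\<^esub> p A
        = \<langle>PMor P A B; \<one>\<^bsub>V\<^esub> \<langle>EHom \<A> B A, PObj Q B\<rangle>\<^bsub>V\<^esub>\<rangle>\<^bsub>V\<^esub>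
            \<cdot>\<^bsub>V\<^esub> \<LL>\<^bsub>V\<^esub> (EHom \<A> B A) (PObj P B) (PObj Q B) \<cdot>\<^bsub>V\<^esub> p B)"

text \<open>
  Since the presheaf hom need not exist, it is a property of an object \<open>H\<close> of \<open>V\<close>
  together with projections \<open>\<pi>\<close>.
\<close>

definition is_presheaf_hom ::
  "('o, 'm) skew_closed_data \<Rightarrow> ('a, 'o, 'm) enriched_data
    \<Rightarrow> ('a, 'o, 'm) presheaf_data \<Rightarrow> ('a, 'o, 'm) presheaf_data
    \<Rightarrow> 'o \<Rightarrow> ('a \<Rightarrow> 'm) \<Rightarrow> bool"
  where "is_presheaf_hom V \<A> P Q H \<pi> \<longleftrightarrow>
    presheaf_hom_cone V \<A> P Q H \<pi> \<and>
    (\<forall>X p. presheaf_hom_cone V \<A> P Q X p \<longrightarrow>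
      (\<exists>!u. u \<in> hom V X H \<and> (\<forall>A \<in> EObj \<A>. \<pi> A \<cdot>\<^bsub>V\<^esub> u = p A)))"

end

theory Submission
  imports Defs
begin

text \<open>
  A morphism \<open>x\<close> into \<open>[\<A>(K,K), PK]\<close> can be evaluated at the identity of \<open>K\<close>: this is
  \<open>i [j\<^sub>K, 1] x\<close>, a morphism into \<open>PK\<close>. The unit axiom of \<open>P\<close> says that evaluation is a left
  inverse of \<open>P\<^sub>K\<^sub>,\<^sub>K\<close>, so a morphism \<open>u\<close> into \<open>PK\<close> is recovered from its composite with the single
  projection \<open>P\<^sub>K\<^sub>,\<^sub>K\<close>. This leaves, for a cone \<open>p\<close>, only the candidate \<open>u = i [j\<^sub>K, 1] p\<^sub>K\<close>.

  The candidate works because \<open>P\<^sub>K\<^sub>,\<^sub>A\<close> can be moved past \<open>i\<close> (naturality) and past \<open>[j\<^sub>K, 1]\<close>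
  (functoriality), where it meets \<open>p\<^sub>K\<close>. The cone condition for the pair \<open>K, A\<close> then trades
  \<open>[1, P\<^sub>K\<^sub>,\<^sub>A] p\<^sub>K\<close> for \<open>[L, 1] L p\<^sub>A\<close>. The axiom \<open>L j = j\<close> of \<open>\<A>\<close> turns the identity of \<open>K\<close> into the
  identity \<open>j\<close> of the object \<open>\<A>(A,K)\<close> of \<open>V\<close>, and \<open>i [j, 1] L = 1\<close> in \<open>V\<close> leaves \<open>p\<^sub>A\<close>:
  \<open>P\<^sub>K\<^sub>,\<^sub>A i [j\<^sub>K, 1] p\<^sub>K = i [j\<^sub>K, 1] [1, P\<^sub>K\<^sub>,\<^sub>A] p\<^sub>K = i [j\<^sub>K, 1] [L, 1] L p\<^sub>A = i [j, 1] L p\<^sub>A = p\<^sub>A\<close>.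
  That the \<open>P\<^sub>K\<^sub>,\<^sub>A\<close> form a cone at all is the associativity axiom of \<open>P\<close>.
\<close>

text \<open>
  Limits are unique up to isomorphism: the comparison back from \<open>H'\<close> composes with \<open>u\<close> to
  endomorphisms that preserve the projections, and the identities are the only such ones.
\<close>

lemma (in left_skew_closed_category) is_iso_presheaf_hom_comparison:
  assumes H: "is_presheaf_hom V \<A> P Q H \<pi>"
    and H': "is_presheaf_hom V \<A> P Q H' \<pi>'"
    and u: "u \<in> Hom H H'"
    and proj_u: "\<And>A. A \<in> EObj \<A> \<Longrightarrow> \<pi>' A \<cdot> u = \<pi> A"
  shows "is_iso V H H' u"
proof -
  have endo_unique: "v = \<one> H"
    if lim: "is_presheaf_hom V \<A> P Q H \<pi>"
      and v: "v \<in> Hom H H" and proj_v: "\<And>A. A \<in> EObj \<A> \<Longrightarrow> \<pi> A \<cdot> v = \<pi> A"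
    for H \<pi> v
  proof -
    have cone: "presheaf_hom_cone V \<A> P Q H \<pi>"
      using lim by (simp add: is_presheaf_hom_def)
    then have ex1: "\<exists>!w. w \<in> Hom H H \<and> (\<forall>A \<in> EObj \<A>. \<pi> A \<cdot> w = \<pi> A)"
      using lim by (simp add: is_presheaf_hom_def)
    have "\<one> H \<in> Hom H H"
      using cone by (simp add: presheaf_hom_cone_def ident_hom)
    moreover have "\<pi> A \<cdot> \<one> H = \<pi> A" if "A \<in> EObj \<A>" for A
      using cone that unfolding presheaf_hom_cone_def by (meson comp_ident_right)
    ultimately show ?thesis
      using the1_equality[OF ex1, of v] the1_equality[OF ex1, of "\<one> H"] v proj_v by simp
  qed
  have cone': "presheaf_hom_cone V \<A> P Q H' \<pi>'"
    using H' by (simp add: is_presheaf_hom_def)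
  have \<pi>: "\<pi> A \<in> Hom H \<langle>PObj P A, PObj Q A\<rangle>" if "A \<in> EObj \<A>" for A
    using H that by (simp add: is_presheaf_hom_def presheaf_hom_cone_def)
  have \<pi>': "\<pi>' A \<in> Hom H' \<langle>PObj P A, PObj Q A\<rangle>" if "A \<in> EObj \<A>" for A
    using cone' that by (simp add: presheaf_hom_cone_def)
  obtain w where w: "w \<in> Hom H' H" and proj_w: "\<And>A. A \<in> EObj \<A> \<Longrightarrow> \<pi> A \<cdot> w = \<pi>' A"
    using H cone' unfolding is_presheaf_hom_def by meson
  have wu: "w \<cdot> u = \<one> H"
  proof (rule endo_unique[OF H comp_hom[OF u w]])
    fix A assume A: "A \<in> EObj \<A>"
    show "\<pi> A \<cdot> w \<cdot> u = \<pi> A"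
      by (simp only: comp_assoc[OF u w \<pi>[OF A], symmetric] proj_w[OF A] proj_u[OF A])
  qed
  have uw: "u \<cdot> w = \<one> H'"
  proof (rule endo_unique[OF H' comp_hom[OF w u]])
    fix A assume A: "A \<in> EObj \<A>"
    show "\<pi>' A \<cdot> u \<cdot> w = \<pi>' A"
      by (simp only: comp_assoc[OF w u \<pi>'[OF A], symmetric] proj_u[OF A] proj_w[OF A])
  qed
  show ?thesis
    unfolding is_iso_def by (intro conjI bexI[of _ w] u w wu uw)
qed

context presheaf
begin

definition evaluate_at_identity :: "'a \<Rightarrow> 'm"
  where "evaluate_at_identity K = \<ii> (PObj P K) \<cdot> \<langle>Ej \<A> K; \<one> (PObj P K)\<rangle>"

lemma evaluate_at_identity_hom:
  assumes "K \<in> EObj \<A>"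
  shows "evaluate_at_identity K \<in> Hom \<langle>EHom \<A> K K, PObj P K\<rangle> (PObj P K)"
  unfolding evaluate_at_identity_def
  using assms by (meson comp_hom i_hom ihom_map_hom Ej_hom ident_hom PObj_obj)

lemma evaluate_at_identity_PMor:
  assumes K: "K \<in> EObj \<A>" and u: "u \<in> Hom X (PObj P K)"
  shows "evaluate_at_identity K \<cdot> PMor P K K \<cdot> u = u"
proof -
  have i: "\<ii> (PObj P K) \<in> Hom \<langle>\<I>, PObj P K\<rangle> (PObj P K)"
    using K by (simp add: i_hom PObj_obj)
  have j: "\<langle>Ej \<A> K; \<one> (PObj P K)\<rangle> \<in> Hom \<langle>EHom \<A> K K, PObj P K\<rangle> \<langle>\<I>, PObj P K\<rangle>"
    using K by (simp add: ihom_map_hom Ej_hom ident_hom PObj_obj)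
  have "evaluate_at_identity K \<cdot> PMor P K K = \<one> (PObj P K)"
    unfolding evaluate_at_identity_def
    by (simp only: comp_assoc[OF PMor_hom[OF K K] j i] presheaf_unit[OF K])
  then show ?thesis
    using comp_assoc[OF u PMor_hom[OF K K] evaluate_at_identity_hom[OF K]]
      comp_ident_left[OF u] by simp
qed

lemma presheaf_hom_cone_PMor:
  assumes "K \<in> EObj \<A>"
  shows "presheaf_hom_cone V \<A> (yoneda \<A> K) P (PObj P K) (PMor P K)"
  unfolding presheaf_hom_cone_def yoneda_def
  using assms by (simp add: PObj_obj PMor_hom presheaf_assoc)

text \<open>
  Existence in the universal property: a cone is determined by its component at \<open>K\<close>, through
  the value of that component at the identity of \<open>K\<close>.
\<close>

lemma PMor_evaluate_at_identity_cone:
  assumes K: "K \<in> EObj \<A>" and A: "A \<in> EObj \<A>"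
    and cone: "presheaf_hom_cone V \<A> (yoneda \<A> K) P X p"
  shows "PMor P K A \<cdot> evaluate_at_identity K \<cdot> p K = p A"
proof -
  let ?E = "EHom \<A> A K" and ?PK = "PObj P K" and ?PA = "PObj P A"
  let ?T = "\<langle>?E, ?PA\<rangle>"
  note [simp] = K A EHom_obj PObj_obj ihom_obj_closed unit_obj_closed ident_hom
  have pK: "p K \<in> Hom X \<langle>EHom \<A> K K, ?PK\<rangle>" and pA: "p A \<in> Hom X ?T"
    using cone K A by (auto simp: presheaf_hom_cone_def yoneda_def)
  have cone_KA:
    "\<langle>\<one> (EHom \<A> K K); PMor P K A\<rangle> \<cdot> p K = \<langle>EL \<A> A K K; \<one> ?T\<rangle> \<cdot> \<LL> ?E ?E ?PA \<cdot> p A"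
    using cone K A by (auto simp: presheaf_hom_cone_def yoneda_def)
  have P: "PMor P K A \<in> Hom ?PK ?T" by (simp add: PMor_hom)
  have j: "Ej \<A> K \<in> Hom \<I> (EHom \<A> K K)" by (simp add: Ej_hom)
  have E: "EL \<A> A K K \<in> Hom (EHom \<A> K K) \<langle>?E, ?E\<rangle>" by (simp add: EL_hom)
  have L: "\<LL> ?E ?E ?PA \<in> Hom ?T \<langle>\<langle>?E, ?E\<rangle>, ?T\<rangle>" by (simp add: L_hom)
  have jPK: "\<langle>Ej \<A> K; \<one> ?PK\<rangle> \<in> Hom \<langle>EHom \<A> K K, ?PK\<rangle> \<langle>\<I>, ?PK\<rangle>"
    using j by (simp add: ihom_map_hom)
  have jT: "\<langle>Ej \<A> K; \<one> ?T\<rangle> \<in> Hom \<langle>EHom \<A> K K, ?T\<rangle> \<langle>\<I>, ?T\<rangle>"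
    using j by (simp add: ihom_map_hom)
  have ET: "\<langle>EL \<A> A K K; \<one> ?T\<rangle> \<in> Hom \<langle>\<langle>?E, ?E\<rangle>, ?T\<rangle> \<langle>EHom \<A> K K, ?T\<rangle>"
    using E by (simp add: ihom_map_hom)
  have IP: "\<langle>\<one> \<I>; PMor P K A\<rangle> \<in> Hom \<langle>\<I>, ?PK\<rangle> \<langle>\<I>, ?T\<rangle>"
    using P by (simp add: ihom_map_hom)
  have KP: "\<langle>\<one> (EHom \<A> K K); PMor P K A\<rangle> \<in> Hom \<langle>EHom \<A> K K, ?PK\<rangle> \<langle>EHom \<A> K K, ?T\<rangle>"
    using P by (simp add: ihom_map_hom)
  have iPK: "\<ii> ?PK \<in> Hom \<langle>\<I>, ?PK\<rangle> ?PK" and iT: "\<ii> ?T \<in> Hom \<langle>\<I>, ?T\<rangle> ?T"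
    by (simp_all add: i_hom)
  have jE: "\<langle>\<jj> ?E; \<one> ?T\<rangle> \<in> Hom \<langle>\<langle>?E, ?E\<rangle>, ?T\<rangle> \<langle>\<I>, ?T\<rangle>"
    by (simp add: ihom_map_hom j_hom)
  \<comment> \<open>Both sides are \<open>[j\<^sub>K, P\<^sub>K\<^sub>,\<^sub>A]\<close>.\<close>
  have interchange:
    "\<langle>\<one> \<I>; PMor P K A\<rangle> \<cdot> \<langle>Ej \<A> K; \<one> ?PK\<rangle> = \<langle>Ej \<A> K; \<one> ?T\<rangle> \<cdot> \<langle>\<one> (EHom \<A> K K); PMor P K A\<rangle>"
    using ihom_comp[OF j ident_hom[of \<I>] ident_hom[of ?PK] P]
      ihom_comp[OF ident_hom[of "EHom \<A> K K"] j P ident_hom[of ?T]]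
    by (simp add: comp_ident_left[OF j] comp_ident_right[OF j]
        comp_ident_left[OF P] comp_ident_right[OF P])
  have identity_of_representable:
    "\<langle>Ej \<A> K; \<one> ?T\<rangle> \<cdot> \<langle>EL \<A> A K K; \<one> ?T\<rangle> = \<langle>\<jj> ?E; \<one> ?T\<rangle>"
    using ihom_comp[OF E j ident_hom[of ?T] ident_hom[of ?T]] enriched_L_j[OF A K]
      comp_ident_left[OF ident_hom[of ?T]] by simp
  have "PMor P K A \<cdot> evaluate_at_identity K \<cdot> p K
      = (PMor P K A \<cdot> \<ii> ?PK) \<cdot> \<langle>Ej \<A> K; \<one> ?PK\<rangle> \<cdot> p K"
    unfolding evaluate_at_identity_def
    by (simp add: comp_assoc[OF pK jPK iPK] comp_assoc[OF comp_hom[OF pK jPK] iPK P])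
  also have "\<dots> = \<ii> ?T \<cdot> (\<langle>\<one> \<I>; PMor P K A\<rangle> \<cdot> \<langle>Ej \<A> K; \<one> ?PK\<rangle>) \<cdot> p K"
    by (simp add: i_natural[OF P] comp_assoc[OF comp_hom[OF pK jPK] IP iT]
        comp_assoc[OF pK jPK IP])
  also have "\<dots> = \<ii> ?T \<cdot> \<langle>Ej \<A> K; \<one> ?T\<rangle> \<cdot> \<langle>\<one> (EHom \<A> K K); PMor P K A\<rangle> \<cdot> p K"
    by (simp add: interchange comp_assoc[OF pK KP jT])
  also have "\<dots> = \<ii> ?T \<cdot> (\<langle>Ej \<A> K; \<one> ?T\<rangle> \<cdot> \<langle>EL \<A> A K K; \<one> ?T\<rangle>) \<cdot> \<LL> ?E ?E ?PA \<cdot> p A"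
    by (simp add: cone_KA comp_assoc[OF comp_hom[OF pA L] ET jT])
  also have "\<dots> = (\<ii> ?T \<cdot> \<langle>\<jj> ?E; \<one> ?T\<rangle> \<cdot> \<LL> ?E ?E ?PA) \<cdot> p A"
    by (simp add: identity_of_representable comp_assoc[OF pA L jE]
        comp_assoc[OF pA comp_hom[OF L jE] iT])
  also have "\<dots> = p A"
    by (simp add: skew_i_j_L comp_ident_left[OF pA])
  finally show ?thesis .
qed

lemma is_presheaf_hom_PMor:
  assumes K: "K \<in> EObj \<A>"
  shows "is_presheaf_hom V \<A> (yoneda \<A> K) P (PObj P K) (PMor P K)"
  unfolding is_presheaf_hom_def
proof (intro conjI allI impI)
  show "presheaf_hom_cone V \<A> (yoneda \<A> K) P (PObj P K) (PMor P K)"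
    using K by (rule presheaf_hom_cone_PMor)
next
  fix X p
  assume cone: "presheaf_hom_cone V \<A> (yoneda \<A> K) P X p"
  then have pK: "p K \<in> Hom X \<langle>EHom \<A> K K, PObj P K\<rangle>"
    using K by (simp add: presheaf_hom_cone_def yoneda_def)
  show "\<exists>!u. u \<in> Hom X (PObj P K) \<and> (\<forall>A \<in> EObj \<A>. PMor P K A \<cdot> u = p A)"
  proof (rule ex1I[of _ "evaluate_at_identity K \<cdot> p K"])
    show "evaluate_at_identity K \<cdot> p K \<in> Hom X (PObj P K)
      \<and> (\<forall>A \<in> EObj \<A>. PMor P K A \<cdot> evaluate_at_identity K \<cdot> p K = p A)"
      using comp_hom[OF pK evaluate_at_identity_hom[OF K]]
        PMor_evaluate_at_identity_cone[OF K _ cone] by blast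
  next
    fix u
    assume "u \<in> Hom X (PObj P K) \<and> (\<forall>A \<in> EObj \<A>. PMor P K A \<cdot> u = p A)"
    then show "u = evaluate_at_identity K \<cdot> p K"
      using evaluate_at_identity_PMor[OF K, of u X] K by simp
  qed
qed

end

theorem theorem15:
  fixes V :: "('o, 'm) skew_closed_data"
    and \<A> :: "('a, 'o, 'm) enriched_data"
    and P :: "('a, 'o, 'm) presheaf_data"
    and K :: 'a
  assumes "left_skew_closed_category V"
    and "enriched_category V \<A>"
    and "K \<in> EObj \<A>"
    and "presheaf V \<A> P"
  shows "presheaf_hom_cone V \<A> (yoneda \<A> K) P (PObj P K) (\<lambda>A. PMor P K A)
    \<and> is_presheaf_hom V \<A> (yoneda \<A> K) P (PObj P K) (\<lambda>A. PMor P K A)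
    \<and> (\<forall>H \<pi>. is_presheaf_hom V \<A> (yoneda \<A> K) P H \<pi> \<longrightarrow>
      (\<exists>!u. u \<in> hom V (PObj P K) H \<and> (\<forall>A \<in> EObj \<A>. \<pi> A \<cdot>\<^bsub>V\<^esub> u = PMor P K A)) \<and>
      (\<forall>u \<in> hom V (PObj P K) H. (\<forall>A \<in> EObj \<A>. \<pi> A \<cdot>\<^bsub>V\<^esub> u = PMor P K A) \<longrightarrow>
        is_iso V (PObj P K) H u))"
proof -
  interpret presheaf V \<A> P by fact
  note cone = presheaf_hom_cone_PMor[OF \<open>K \<in> EObj \<A>\<close>]
    and lim = is_presheaf_hom_PMor[OF \<open>K \<in> EObj \<A>\<close>]
  show ?thesis
  proof (intro conjI allI impI ballI)
    show "presheaf_hom_cone V \<A> (yoneda \<A> K) P (PObj P K) (\<lambda>A. PMor P K A)"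
      by (rule cone)
    show "is_presheaf_hom V \<A> (yoneda \<A> K) P (PObj P K) (\<lambda>A. PMor P K A)"
      by (rule lim)
    fix H \<pi>
    assume H: "is_presheaf_hom V \<A> (yoneda \<A> K) P H \<pi>"
    then show "\<exists>!u. u \<in> hom V (PObj P K) H \<and> (\<forall>A \<in> EObj \<A>. \<pi> A \<cdot>\<^bsub>V\<^esub> u = PMor P K A)"
      using cone by (simp add: is_presheaf_hom_def)
    fix u
    assume "u \<in> hom V (PObj P K) H" "\<forall>A \<in> EObj \<A>. \<pi> A \<cdot>\<^bsub>V\<^esub> u = PMor P K A"
    then show "is_iso V (PObj P K) H u"
      by (intro is_iso_presheaf_hom_comparison[OF lim H]) simp_all
  qed
qed

end
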